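(* For $p,q\in\mathbb{R}$ let $$\begin{aligned}\mathfrak{g}_{pq}(x,y,z) := {}& z^3+q^2x^2z+p^2y^2z-2qxz^2-2pyz^2-(p^2+q^2-4p-4q+3)xyz\\&+(1-p+q)(1-p-q)x^2y+(1+p-q)(1-p-q)xy^2.\end{aligned}$$ If $p\ge 0$, $q\ge 0$ and $p+q\le 1$, then $\mathfrak{g}_{pq}\in\mathcal{E}(\mathcal{P}_{3,3}^+)$ and $$\mathfrak{g}_{pq}(1,1,1)=\mathfrak{g}_{pq}(0,1,p)=\mathfrak{g}_{pq}(1,0,q)=\mathfrak{g}_{pq}(1,0,0)=\mathfrak{g}_{pq}(0,1,0)=0.$$ Conversely, if $p>0$, $q>0$, $p+q<1$ and $f\in\mathcal{P}_{3,3}^+$ satisfies $f(1,1,1)=f(0,1,p)=f(1,0,q)=f(1,0,0)=f(0,1,0)=0$, then there exists $\alpha\in\mathbb{R}$ such that $f=\alpha\,\mathfrak{g}_{pq}$.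
   Context: $\mathcal{H}_{3,3}$ is the real vector space of homogeneous polynomials of degree $3$ in $x,y,z$ with real coefficients (including $0$). $\mathcal{P}_{3,3}^+$ is the set of $f\in\mathcal{H}_{3,3}$ with $f(x,y,z)\ge 0$ for all real $x,y,z\ge 0$. For a closed convex cone $\mathcal{P}$ containing no lines, a nonzero $f\in\mathcal{P}$ is extremal if $f=g+h$ with $g,h\in\mathcal{P}$ implies that $g$ and $h$ are scalar multiples of $f$; $\mathcal{E}(\mathcal{P})$ is the set of extremal elements of $\mathcal{P}$. *)

theory Defs
  imports Complex_Main
begin

text \<open>
  Since \<open>\<real>\<close> is infinite, a real polynomial is determined by the function it induces; ternary cubic
  forms are therefore represented as functions on \<open>\<real> \<times> \<real> \<times> \<real>\<close>, and \<open>f(x,y,z)\<close> is application.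
\<close>

definition H33 :: "(real \<times> real \<times> real \<Rightarrow> real) set" where
  "H33 = {f. \<exists>c :: nat \<Rightarrow> nat \<Rightarrow> real.
      f = (\<lambda>(x, y, z). \<Sum>i\<le>3. \<Sum>j\<le>3 - i. c i j * x ^ i * y ^ j * z ^ (3 - i - j))}"

definition P33plus :: "(real \<times> real \<times> real \<Rightarrow> real) set" where
  "P33plus = {f \<in> H33. \<forall>x y z. x \<ge> 0 \<longrightarrow> y \<ge> 0 \<longrightarrow> z \<ge> 0 \<longrightarrow> f (x, y, z) \<ge> 0}"

text \<open>
  Extremal elements of a cone \<open>P\<close> in a space of real-valued functions with the pointwise
  operations; the notion is meant for closed convex cones containing no lines.
\<close>

definition extremals :: "('a \<Rightarrow> real) set \<Rightarrow> ('a \<Rightarrow> real) set" where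
  "extremals P = {f \<in> P. f \<noteq> (\<lambda>v. 0) \<and>
      (\<forall>g\<in>P. \<forall>h\<in>P. f = (\<lambda>v. g v + h v) \<longrightarrow>
        (\<exists>a. g = (\<lambda>v. a * f v)) \<and> (\<exists>b. h = (\<lambda>v. b * f v)))}"

definition gpq :: "real \<Rightarrow> real \<Rightarrow> real \<times> real \<times> real \<Rightarrow> real" where
  "gpq p q = (\<lambda>(x, y, z).
      z^3 + q^2 * x^2 * z + p^2 * y^2 * z - 2 * q * x * z^2 - 2 * p * y * z^2
      - (p^2 + q^2 - 4 * p - 4 * q + 3) * x * y * z
      + (1 - p + q) * (1 - p - q) * x^2 * y + (1 + p - q) * (1 - p - q) * x * y^2)"

end

theory Submission
  imports Defs
begin

text \<open>
  Put \<open>t = 1 - p - q\<close> and \<open>w = z - q x - p y\<close>. Then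
  \<open>gpq = z w\<^sup>2 - 2 t x y w + t\<^sup>2 x y (x + y - z)\<close>, and completing the square in \<open>w\<close> gives
  \<open>z gpq = (z w - t x y)\<^sup>2 - t\<^sup>2 x y (z - x) (z - y)\<close>. For \<open>z > 0\<close>, nonnegativity is therefore clear
  if \<open>z\<close> lies between \<open>x\<close> and \<open>y\<close>. Otherwise \<open>z - x\<close> and \<open>z - y\<close> have the same sign, and then
  \<open>z w - t x y\<close> is in absolute value at least \<open>t \<bar>z\<^sup>2 - x y\<bar>\<close>, which is large enough.

  A form \<open>f\<close> in the cone with the five zeros is pinned down as follows. On the face \<open>x = 0\<close> it
  restricts to a cubic that is nonnegative on the half-line and vanishes at \<open>(0,1,0)\<close> and
  \<open>(0,1,p)\<close>. If \<open>p > 0\<close>, the second zero is a minimum in the interior of the half-line, hence a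
  double root, so the restriction is \<open>c z (z - p y)\<^sup>2\<close>, where \<open>c\<close> is the coefficient of \<open>z\<^sup>3\<close>.
  The same holds on \<open>y = 0\<close> with the same \<open>c\<close>. Consequently \<open>f - c gpq = x y (m z + \<alpha> x + \<beta> y)\<close>.
  Both \<open>f\<close> and \<open>gpq\<close> have a minimum at the interior point \<open>(1,1,1)\<close>, so the gradient of the
  difference vanishes there, which forces \<open>\<alpha> = \<beta> = m = 0\<close>.

  For extremality, a summand \<open>f\<close> of \<open>gpq\<close> satisfies \<open>0 \<le> f \<le> gpq\<close> on the octant and so inherits
  the zeros of \<open>gpq\<close>. If \<open>p = 0\<close>, the zeros \<open>(0,1,0)\<close> and \<open>(0,1,p)\<close> coincide and the double root is
  lost, but the bound \<open>f(0,1,t) \<le> gpq(0,1,t) = t\<^sup>3\<close> leaves only the multiples of \<open>t\<^sup>3\<close>. Assuming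
  \<open>p > 0\<close> or this bound, and likewise for \<open>q\<close>, covers extremality and uniqueness by one
  argument.
\<close>

lemma H33_coefficients:
  assumes "f \<in> H33"
  obtains a b c d e l1 l2 m1 m2 n where
    "\<And>x y z. f (x, y, z) = a * x^3 + b * y^3 + c * z^3 + d * x^2 * y + e * x * y^2
        + l1 * y^2 * z + l2 * y * z^2 + m1 * x^2 * z + m2 * x * z^2 + n * x * y * z"
proof -
  obtain k :: "nat \<Rightarrow> nat \<Rightarrow> real" where
    k: "f = (\<lambda>(x, y, z). \<Sum>i\<le>3. \<Sum>j\<le>3 - i. k i j * x ^ i * y ^ j * z ^ (3 - i - j))"
    using assms by (auto simp: H33_def)
  have "f (x, y, z) = k 3 0 * x^3 + k 0 3 * y^3 + k 0 0 * z^3 + k 2 1 * x^2 * y + k 1 2 * x * y^2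
        + k 0 2 * y^2 * z + k 0 1 * y * z^2 + k 2 0 * x^2 * z + k 1 0 * x * z^2 + k 1 1 * x * y * z"
    for x y z
    unfolding k by (simp add: eval_nat_numeral algebra_simps)
  then show thesis by (rule that)
qed

lemma gpq_in_H33: "gpq p q \<in> H33"
proof -
  define k :: "nat \<Rightarrow> nat \<Rightarrow> real" where "k = (\<lambda>i j.
    if (i, j) = (0, 0) then 1
    else if (i, j) = (2, 0) then q^2
    else if (i, j) = (0, 2) then p^2
    else if (i, j) = (1, 0) then - 2 * q
    else if (i, j) = (0, 1) then - 2 * p
    else if (i, j) = (1, 1) then - (p^2 + q^2 - 4 * p - 4 * q + 3)
    else if (i, j) = (2, 1) then (1 - p + q) * (1 - p - q)
    else if (i, j) = (1, 2) then (1 + p - q) * (1 - p - q)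
    else 0)"
  have "gpq p q = (\<lambda>(x, y, z). \<Sum>i\<le>3. \<Sum>j\<le>3 - i. k i j * x ^ i * y ^ j * z ^ (3 - i - j))"
    by (rule ext) (simp add: gpq_def k_def eval_nat_numeral algebra_simps split: prod.split)
  then show ?thesis by (auto simp: H33_def)
qed

lemma gpq_complete_square:
  "z * gpq p q (x, y, z) = (z * (z - q * x - p * y) - (1 - p - q) * x * y)^2
     - (1 - p - q)^2 * (x * y * ((z - x) * (z - y)))"
  unfolding gpq_def by (simp add: power2_eq_square power3_eq_cube algebra_simps)

text \<open>
  Two factorizations of \<open>z\<^sup>2 - x y\<close>, namely \<open>z (z - x) + x (z - y)\<close> and \<open>y (z - x) + z (z - y)\<close>,
  have all summands of one sign here; multiplying the second summand of the one by the first
  summand of the other gives exactly \<open>x y (z - x) (z - y)\<close>.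
\<close>

lemma product_le_square_of_same_sign:
  fixes x y z :: real
  assumes "x \<ge> 0" "y \<ge> 0" "z \<ge> 0" and "x \<le> z \<and> y \<le> z \<or> z \<le> x \<and> z \<le> y"
  shows "x * y * ((z - x) * (z - y)) \<le> (z^2 - x * y)^2"
proof -
  have sq: "(z^2 - x * y)^2 = (z * (z - x) + x * (z - y)) * (y * (z - x) + z * (z - y))"
    by (simp add: power2_eq_square algebra_simps)
  have split: "(z * (z - x) + x * (z - y)) * (y * (z - x) + z * (z - y))
      = x * y * ((z - x) * (z - y)) + z * y * (z - x)^2 + z^2 * ((z - x) * (z - y))
        + x * z * (z - y)^2"
    by (simp add: power2_eq_square algebra_simps)
  have "(z - x) * (z - y) \<ge> 0"
    using assms(4) by (auto intro: mult_nonneg_nonneg mult_nonpos_nonpos)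
  then show ?thesis
    unfolding sq split using assms(1-3) by simp
qed

lemma gpq_nonneg:
  assumes pq: "p \<ge> 0" "q \<ge> 0" "p + q \<le> 1" and "x \<ge> 0" "y \<ge> 0" "z \<ge> 0"
  shows "gpq p q (x, y, z) \<ge> 0"
proof (cases "z = 0")
  case True
  then show ?thesis using assms by (simp add: gpq_def)
next
  case False
  define t where "t = 1 - p - q"
  define s where "s = z * (z - q * x - p * y) - t * x * y"
  have t: "t \<ge> 0" using pq by (simp add: t_def)
  have s: "s = t * (z^2 - x * y) + z * (q * (z - x) + p * (z - y))"
    by (simp add: s_def t_def power2_eq_square algebra_simps)
  have "t^2 * (x * y * ((z - x) * (z - y))) \<le> s^2"
  proof (cases "x \<le> z \<and> y \<le> z \<or> z \<le> x \<and> z \<le> y")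
    case True
    have "\<bar>t * (z^2 - x * y)\<bar> \<le> \<bar>s\<bar>"
      using True
    proof
      assume "x \<le> z \<and> y \<le> z"
      then have "x * y \<le> z^2" "0 \<le> z * (q * (z - x) + p * (z - y))"
        using assms by (auto simp: power2_eq_square intro!: mult_mono)
      then show ?thesis unfolding s using t by simp
    next
      assume h: "z \<le> x \<and> z \<le> y"
      have "z^2 \<le> x * y" using h assms by (auto simp: power2_eq_square intro!: mult_mono)
      then have "t * (z^2 - x * y) \<le> 0" using t by (simp add: mult_nonneg_nonpos)
      moreover have "q * (z - x) + p * (z - y) \<le> 0"
        using h pq by (intro add_nonpos_nonpos mult_nonneg_nonpos) auto
      then have "z * (q * (z - x) + p * (z - y)) \<le> 0"
        using assms by (intro mult_nonneg_nonpos) auto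
      ultimately show ?thesis unfolding s by linarith
    qed
    then have "(t * (z^2 - x * y))^2 \<le> s^2"
      by (simp add: abs_le_square_iff)
    moreover have "t^2 * (x * y * ((z - x) * (z - y))) \<le> t^2 * (z^2 - x * y)^2"
      using True assms by (intro mult_left_mono product_le_square_of_same_sign) auto
    ultimately show ?thesis by (simp add: power_mult_distrib)
  next
    case False
    then have "(z - x) * (z - y) \<le> 0"
      unfolding mult_le_0_iff by linarith
    then have "t^2 * (x * y * ((z - x) * (z - y))) \<le> 0"
      using assms by (simp add: mult_nonneg_nonpos)
    then show ?thesis using zero_le_power2[of s] by linarith
  qed
  then have "z * gpq p q (x, y, z) \<ge> 0"
    unfolding gpq_complete_square s_def t_def by simp
  then show ?thesis using False \<open>z \<ge> 0\<close> by (simp add: zero_le_mult_iff)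
qed

lemma gpq_in_P33plus:
  assumes "p \<ge> 0" "q \<ge> 0" "p + q \<le> 1"
  shows "gpq p q \<in> P33plus"
  using gpq_in_H33 gpq_nonneg[OF assms] by (simp add: P33plus_def)

lemma gpq_zeros:
  "gpq p q (1, 1, 1) = 0" "gpq p q (0, 1, p) = 0" "gpq p q (1, 0, q) = 0"
  "gpq p q (1, 0, 0) = 0" "gpq p q (0, 1, 0) = 0"
  unfolding gpq_def by (simp_all add: power2_eq_square power3_eq_cube algebra_simps)

lemma cubic_interior_zero_deriv:
  fixes a b c d u :: real
  assumes nn: "\<And>t. t \<ge> 0 \<Longrightarrow> a + b * t + c * t^2 + d * t^3 \<ge> 0"
    and zero: "a + b * u + c * u^2 + d * u^3 = 0" and "u > 0"
  shows "b + 2 * c * u + 3 * d * u^2 = 0"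
proof -
  have "((\<lambda>t. a + b * t + c * t^2 + d * t^3) has_field_derivative b + 2 * c * u + 3 * d * u^2) (at u)"
    by (auto intro!: derivative_eq_intros)
  then show ?thesis
    by (rule DERIV_local_min[where d = u]) (use assms in auto)
qed

lemma zero_at_0_if_squeezed:
  fixes a b c :: real
  assumes "\<And>t. t > 0 \<Longrightarrow> 0 \<le> a + b * t + c * t^2" "\<And>t. t > 0 \<Longrightarrow> t \<le> 1 \<Longrightarrow> a + b * t + c * t^2 \<le> t"
  shows "a = 0"
proof -
  have "((\<lambda>t. a + b * t + c * t^2) \<longlongrightarrow> 0) (at_right 0)"
  proof (rule tendsto_sandwich)
    show "\<forall>\<^sub>F t in at_right 0. 0 \<le> a + b * t + c * t^2"
      using assms(1) by (auto simp: eventually_at_right_field intro: exI[of _ 1])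
    show "\<forall>\<^sub>F t in at_right 0. a + b * t + c * t^2 \<le> t"
      using assms(2) by (auto simp: eventually_at_right_field intro!: exI[of _ 1])
  qed (auto intro: tendsto_eq_intros)
  moreover have "((\<lambda>t. a + b * t + c * t^2) \<longlongrightarrow> a) (at_right 0)"
    by (auto intro!: tendsto_eq_intros)
  ultimately show ?thesis
    using tendsto_unique[OF trivial_limit_at_right_real] by blast
qed

text \<open>
  The conclusion says that the cubic is \<open>d t (t - u)\<^sup>2\<close>. For \<open>u > 0\<close> the zero \<open>u\<close> is a minimum and
  hence a double root. For \<open>u = 0\<close> the cubic is squeezed between \<open>0\<close> and \<open>t\<^sup>3\<close>, and dividing by
  \<open>t\<close> and letting \<open>t\<close> tend to \<open>0\<close> removes first the linear and then the quadratic term.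
\<close>

lemma cubic_with_double_root:
  fixes b c d u :: real
  assumes nn: "\<And>t. t \<ge> 0 \<Longrightarrow> b * t + c * t^2 + d * t^3 \<ge> 0"
    and zero: "b * u + c * u^2 + d * u^3 = 0" and "u \<ge> 0"
    and tight: "u > 0 \<or> (\<forall>t\<ge>0. b * t + c * t^2 + d * t^3 \<le> t^3)"
  shows "b = d * u^2 \<and> c = - 2 * d * u"
proof (cases "u > 0")
  case True
  have "b + 2 * c * u + 3 * d * u^2 = 0"
    using cubic_interior_zero_deriv[of 0 b c d u] nn zero True by simp
  moreover have "u * (b + c * u + d * u^2) = 0"
    using zero by (simp add: power2_eq_square power3_eq_cube algebra_simps)
  then have "b + c * u + d * u^2 = 0" using True by simp
  ultimately have "u * (c + 2 * d * u) = 0"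
    by (simp add: power2_eq_square algebra_simps)
  then have "c = - 2 * d * u" using True by simp
  with \<open>b + c * u + d * u^2 = 0\<close> show ?thesis
    by (simp add: power2_eq_square algebra_simps)
next
  case False
  then have u: "u = 0" and le: "\<And>t. t \<ge> 0 \<Longrightarrow> b * t + c * t^2 + d * t^3 \<le> t^3"
    using \<open>u \<ge> 0\<close> tight by auto
  have quad: "0 \<le> b + c * t + d * t^2 \<and> b + c * t + d * t^2 \<le> t^2" if "t > 0" for t
  proof -
    have "t * 0 \<le> t * (b + c * t + d * t^2)" "t * (b + c * t + d * t^2) \<le> t * t^2"
      using nn[of t] le[of t] that by (auto simp: power2_eq_square power3_eq_cube algebra_simps)
    then show ?thesis using that by (simp only: mult_le_cancel_left_pos)
  qed
  have b: "b = 0"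
  proof (rule zero_at_0_if_squeezed)
    show "b + c * t + d * t^2 \<le> t" if "t > 0" "t \<le> 1" for t
    proof -
      have "t^2 \<le> t" using that by (simp add: power2_eq_square mult_left_le)
      then show ?thesis using quad[OF \<open>t > 0\<close>] by linarith
    qed
  qed (use quad in blast)
  have lin: "0 \<le> c + d * t \<and> c + d * t \<le> t" if "t > 0" for t
  proof -
    have "t * 0 \<le> t * (c + d * t)" "t * (c + d * t) \<le> t * t"
      using quad[OF that] b by (auto simp: power2_eq_square algebra_simps)
    then show ?thesis using that by (simp only: mult_le_cancel_left_pos)
  qed
  have "c = 0"
    by (rule zero_at_0_if_squeezed[of c d 0]) (use lin in auto)
  then show ?thesis using b u by simp
qed

text \<open>
  The disjunctions let one statement serve both halves of the theorem: uniqueness supplies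
  \<open>p, q > 0\<close>, while a summand of \<open>gpq\<close> satisfies the bounds by \<open>t\<^sup>3\<close> whenever \<open>p\<close> or \<open>q\<close> is zero.
\<close>

lemma P33plus_determined_by_zeros:
  assumes f: "f \<in> P33plus" and pq: "p \<ge> 0" "q \<ge> 0"
    and zeros: "f (1, 1, 1) = 0" "f (0, 1, p) = 0" "f (1, 0, q) = 0"
      "f (1, 0, 0) = 0" "f (0, 1, 0) = 0"
    and tight_p: "p > 0 \<or> (\<forall>t\<ge>0. f (0, 1, t) \<le> t^3)"
    and tight_q: "q > 0 \<or> (\<forall>t\<ge>0. f (1, 0, t) \<le> t^3)"
  shows "f = (\<lambda>v. f (0, 0, 1) * gpq p q v)"
proof -
  have nn: "f (x, y, z) \<ge> 0" if "x \<ge> 0" "y \<ge> 0" "z \<ge> 0" for x y z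
    using f that by (simp add: P33plus_def)
  obtain a b c d e l1 l2 m1 m2 n where
    F: "\<And>x y z. f (x, y, z) = a * x^3 + b * y^3 + c * z^3 + d * x^2 * y + e * x * y^2
        + l1 * y^2 * z + l2 * y * z^2 + m1 * x^2 * z + m2 * x * z^2 + n * x * y * z"
    using f by (auto simp: P33plus_def elim: H33_coefficients)
  have ab: "a = 0" "b = 0" using zeros by (simp_all add: F)
  have l: "l1 = c * p^2 \<and> l2 = - 2 * c * p"
    by (rule cubic_with_double_root)
      (use nn[of 0 1] zeros(2) pq(1) tight_p in \<open>simp_all add: F ab algebra_simps\<close>)
  have m: "m1 = c * q^2 \<and> m2 = - 2 * c * q"
    by (rule cubic_with_double_root)
      (use nn[of 1 0] zeros(3) pq(2) tight_q in \<open>simp_all add: F ab algebra_simps\<close>)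
  have sum1: "c + d + e + l1 + l2 + m1 + m2 + n = 0"
    using zeros(1) by (simp add: F ab)
  \<comment> \<open>The partial derivatives at \<open>(1,1,1)\<close> with respect to \<open>x\<close> and \<open>y\<close>; by Euler's identity the
    one with respect to \<open>z\<close> carries no further information.\<close>
  have dx: "(e + m2 + n) + 2 * (d + m1) * 1 + 3 * 0 * 1^2 = 0"
    by (rule cubic_interior_zero_deriv[where a = "c + l1 + l2"])
      (use nn[of _ 1 1] sum1 in \<open>simp_all add: F ab algebra_simps\<close>)
  have dy: "(d + l2 + n) + 2 * (e + l1) * 1 + 3 * 0 * 1^2 = 0"
    by (rule cubic_interior_zero_deriv[where a = "c + m1 + m2"])
      (use nn[of 1 _ 1] sum1 in \<open>simp_all add: F ab algebra_simps\<close>)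
  have d: "d = c * ((1 - p + q) * (1 - p - q))"
  proof -
    have "d = c + l1 + l2 - m1" using sum1 dx by simp
    then show ?thesis using l m by (simp add: power2_eq_square algebra_simps)
  qed
  have e: "e = c * ((1 + p - q) * (1 - p - q))"
  proof -
    have "e = c + m1 + m2 - l1" using sum1 dy by simp
    then show ?thesis using l m by (simp add: power2_eq_square algebra_simps)
  qed
  have n: "n = - c * (p^2 + q^2 - 4 * p - 4 * q + 3)"
  proof -
    have "n = - (c + d + e + l1 + l2 + m1 + m2)" using sum1 by linarith
    then show ?thesis using l m d e by (simp add: power2_eq_square algebra_simps)
  qed
  have "f (x, y, z) = c * gpq p q (x, y, z)" for x y z
    unfolding F gpq_def using l m by (simp add: ab d e n algebra_simps)
  moreover have "f (0, 0, 1) = c" by (simp add: F)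
  ultimately show ?thesis by auto
qed

lemma summand_of_gpq_is_multiple:
  assumes pq: "p \<ge> 0" "q \<ge> 0" and g: "g \<in> P33plus" and h: "h \<in> P33plus"
    and sum: "gpq p q = (\<lambda>v. g v + h v)"
  shows "\<exists>a. g = (\<lambda>v. a * gpq p q v)"
proof -
  have bounds: "0 \<le> g (x, y, z) \<and> g (x, y, z) \<le> gpq p q (x, y, z)"
    if "x \<ge> 0" "y \<ge> 0" "z \<ge> 0" for x y z
    using g h that by (simp add: sum P33plus_def)
  have "g = (\<lambda>v. g (0, 0, 1) * gpq p q v)"
  proof (rule P33plus_determined_by_zeros[OF g pq])
    show "p > 0 \<or> (\<forall>t\<ge>0. g (0, 1, t) \<le> t^3)"
      using bounds[of 0 1] pq(1) by (cases "p = 0") (auto simp: gpq_def)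
    show "q > 0 \<or> (\<forall>t\<ge>0. g (1, 0, t) \<le> t^3)"
      using bounds[of 1 0] pq(2) by (cases "q = 0") (auto simp: gpq_def)
  qed (use bounds[of 1 1 1] bounds[of 0 1 p] bounds[of 1 0 q] bounds[of 1 0 0] bounds[of 0 1 0]
        pq gpq_zeros[of p q] in auto)
  then show ?thesis by blast
qed

lemma gpq_extremal:
  assumes "p \<ge> 0" "q \<ge> 0" "p + q \<le> 1"
  shows "gpq p q \<in> extremals P33plus"
proof -
  have "gpq p q (0, 0, 1) = 1" by (simp add: gpq_def)
  then have "gpq p q \<noteq> (\<lambda>v. 0)" by auto
  moreover have "(\<exists>a. g = (\<lambda>v. a * gpq p q v)) \<and> (\<exists>b. h = (\<lambda>v. b * gpq p q v))"
    if "g \<in> P33plus" "h \<in> P33plus" "gpq p q = (\<lambda>v. g v + h v)" for g h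
  proof
    show "\<exists>a. g = (\<lambda>v. a * gpq p q v)"
      by (rule summand_of_gpq_is_multiple[OF assms(1,2) that])
    have "gpq p q = (\<lambda>v. h v + g v)" using that(3) by (simp add: add.commute)
    then show "\<exists>b. h = (\<lambda>v. b * gpq p q v)"
      by (rule summand_of_gpq_is_multiple[OF assms(1,2) that(2,1)])
  qed
  ultimately show ?thesis
    unfolding extremals_def using gpq_in_P33plus[OF assms] by blast
qed

theorem theorem1p2:
  fixes p q :: real
  shows "(p \<ge> 0 \<and> q \<ge> 0 \<and> p + q \<le> 1 \<longrightarrow>
            gpq p q \<in> extremals P33plus \<and>
            gpq p q (1, 1, 1) = 0 \<and> gpq p q (0, 1, p) = 0 \<and> gpq p q (1, 0, q) = 0 \<and>
            gpq p q (1, 0, 0) = 0 \<and> gpq p q (0, 1, 0) = 0)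
       \<and> (p > 0 \<and> q > 0 \<and> p + q < 1 \<longrightarrow>
            (\<forall>f\<in>P33plus.
               f (1, 1, 1) = 0 \<and> f (0, 1, p) = 0 \<and> f (1, 0, q) = 0 \<and>
               f (1, 0, 0) = 0 \<and> f (0, 1, 0) = 0 \<longrightarrow>
               (\<exists>\<alpha>::real. f = (\<lambda>v. \<alpha> * gpq p q v))))"
proof (intro conjI impI ballI; elim conjE)
  show "gpq p q \<in> extremals P33plus" if "p \<ge> 0" "q \<ge> 0" "p + q \<le> 1"
    using that by (rule gpq_extremal)
  show "\<exists>\<alpha>. f = (\<lambda>v. \<alpha> * gpq p q v)"
    if "p > 0" "q > 0" "f \<in> P33plus" "f (1, 1, 1) = 0" "f (0, 1, p) = 0" "f (1, 0, q) = 0"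
      "f (1, 0, 0) = 0" "f (0, 1, 0) = 0" for f
    using P33plus_determined_by_zeros[of f p q] that by (intro exI[of _ "f (0, 0, 1)"]) auto
qed (rule gpq_zeros)+

end
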